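(* Let $\kappa=(\kappa_t)_{t\in\mathbb R_+}$ be a $[1,\infty)$-valued $(\mathcal F_t)$-adapted process with c\`adl\`ag paths, satisfying $\limsup_{t\to\infty}\kappa_t=\infty$ a.s. Suppose that there exist a level $\ell\in(1,\infty)$ and a non-decreasing continuous function $\varphi:(0,1]\to\mathbb R_+$ such that the process $$\left(\frac1{\kappa_{(\rho_{r_q}+t)\wedge\lambda_{r,\rho_{r_q}}}}-\int_{\rho_{r_q}}^{(\rho_{r_q}+t)\wedge\lambda_{r,\rho_{r_q}}}\varphi(1/\kappa_u)\,du\right)_{t\in\mathbb R_+}\quad\text{is an }(\mathcal F_{\rho_{r_q}+t})\text{-supermartingale}$$ for every $q\in(0,1)$ and $r\in(\ell,\infty)$, where $r_q:=2r/(1-q)$. Pick any $q\in(0,1)$, $\varepsilon\in(0,(1-q)/2]$ and a non-decreasing function $f:\mathbb R_+\to\mathbb R_+$. Then for every $r\in(\ell,\infty)$ we have $$\mathbb P\left(\int_0^{\lambda_\ell}f(\kappa_s)\,ds\ge\frac{f(r)\varepsilon}{r\varphi(1/r)}\,\Big|\,\mathcal F_0\right)\ge q\,\mathbb P(\rho_{r_q}<\lambda_\ell\,|\,\mathcal F_0)\qquad\text{a.s.}$$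
   Context: $\mathbb R_+=[0,\infty)$. $(\Omega,\mathcal F,\mathbb P)$ is a probability space with a right-continuous filtration $(\mathcal F_t)_{t\in\mathbb R_+}$; $s\wedge t=\min\{s,t\}$; $\inf\emptyset=\infty$. For $\ell,r\in\mathbb R_+$ and a $[0,\infty]$-valued $(\mathcal F_t)$-stopping time $T$ define $\lambda_{\ell,T}:=T+\inf\{s\in\mathbb R_+:T<\infty,\ \kappa_{T+s}<\ell\}$ and $\rho_{r,T}:=T+\inf\{s\in\mathbb R_+:T<\infty,\ \kappa_{T+s}>r\}$; write $\lambda_\ell:=\lambda_{\ell,0}$ and $\rho_r:=\rho_{r,0}$. *)

theory Defs
  imports "HOL-Probability.Probability"
begin

(* A process or filtration with index set [0, infinity) is a function on all of real; its values at
   negative times are never used.  Stopping times take values in ennreal = [0, infinity].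
   Adding the full sigma-algebra at time infinity turns a filtration indexed by [0, infinity) into
   one indexed by ennreal, to which the library's filtration and pre_sigma apply. *)
definition with_top :: "'a measure \<Rightarrow> (real \<Rightarrow> 'a measure) \<Rightarrow> ennreal \<Rightarrow> 'a measure" where
  "with_top M F t = (if t = \<infinity> then M else F (enn2real t))"

definition filtration_of :: "'a measure \<Rightarrow> (real \<Rightarrow> 'a measure) \<Rightarrow> bool" where
  "filtration_of M F \<longleftrightarrow> filtration (space M) (with_top M F)"

definition right_continuous_filtration :: "(real \<Rightarrow> 'a measure) \<Rightarrow> bool" where
  "right_continuous_filtration F \<longleftrightarrow> (\<forall>t\<ge>0. sets (F t) = (\<Inter>s\<in>{t<..}. sets (F s)))"

(* By pre_sigma for with_top M F: the measurable sets A such that A \<inter> {T \<le> t} is in F t for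
   every t < infinity. *)
definition stopped_sigma :: "'a measure \<Rightarrow> (real \<Rightarrow> 'a measure) \<Rightarrow> ('a \<Rightarrow> ennreal) \<Rightarrow> 'a measure" where
  "stopped_sigma M F T = filtration.pre_sigma (space M) (with_top M F) T"

definition adapted :: "(real \<Rightarrow> 'a measure) \<Rightarrow> (real \<Rightarrow> 'a \<Rightarrow> real) \<Rightarrow> bool" where
  "adapted F X \<longleftrightarrow> (\<forall>t\<ge>0. X t \<in> borel_measurable (F t))"

definition cadlag :: "(real \<Rightarrow> real) \<Rightarrow> bool" where
  "cadlag x \<longleftrightarrow> (\<forall>t\<ge>0. (x \<longlongrightarrow> x t) (at_right t)) \<and> (\<forall>t>0. \<exists>l. (x \<longlongrightarrow> l) (at_left t))"

definition supermartingale ::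
  "'a measure \<Rightarrow> (real \<Rightarrow> 'a measure) \<Rightarrow> (real \<Rightarrow> 'a \<Rightarrow> real) \<Rightarrow> bool" where
  "supermartingale M G X \<longleftrightarrow>
     filtration_of M G \<and> adapted G X \<and> (\<forall>t\<ge>0. integrable M (X t)) \<and>
     (\<forall>s\<ge>0. \<forall>t\<ge>s. AE \<omega> in M. real_cond_exp M (G s) (X t) \<omega> \<le> X s \<omega>)"

definition cond_probability :: "'a measure \<Rightarrow> 'a measure \<Rightarrow> ('a \<Rightarrow> bool) \<Rightarrow> 'a \<Rightarrow> real" where
  "cond_probability M G P = real_cond_exp M G (indicator {\<omega> \<in> space M. P \<omega>})"

definition lower_time ::
  "(real \<Rightarrow> 'a \<Rightarrow> real) \<Rightarrow> real \<Rightarrow> ('a \<Rightarrow> ennreal) \<Rightarrow> 'a \<Rightarrow> ennreal" where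
  "lower_time \<kappa> l T \<omega> =
     T \<omega> + Inf {ennreal s | s. 0 \<le> s \<and> T \<omega> < \<infinity> \<and> \<kappa> (enn2real (T \<omega>) + s) \<omega> < l}"

definition upper_time ::
  "(real \<Rightarrow> 'a \<Rightarrow> real) \<Rightarrow> real \<Rightarrow> ('a \<Rightarrow> ennreal) \<Rightarrow> 'a \<Rightarrow> ennreal" where
  "upper_time \<kappa> r T \<omega> =
     T \<omega> + Inf {ennreal s | s. 0 \<le> s \<and> T \<omega> < \<infinity> \<and> \<kappa> (enn2real (T \<omega>) + s) \<omega> > r}"

(* With S = (T + t) \<and> lower_time \<kappa> r T, the process 1 / \<kappa> S - \<integral> \<phi> (1 / \<kappa> u) du over [T, S].
   S is finite wherever T is.  Where T is infinite the expression has no meaning, and the value is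
   set to 0; below, T is almost surely finite. *)
definition compensated_inverse ::
  "(real \<Rightarrow> 'a \<Rightarrow> real) \<Rightarrow> (real \<Rightarrow> real) \<Rightarrow> real \<Rightarrow> ('a \<Rightarrow> ennreal) \<Rightarrow> real \<Rightarrow> 'a \<Rightarrow> real" where
  "compensated_inverse \<kappa> \<phi> r T t \<omega> =
     (if T \<omega> < \<infinity> then
        (let S = enn2real (min (T \<omega> + ennreal t) (lower_time \<kappa> r T \<omega>))
         in 1 / \<kappa> S \<omega> - (LBINT u:{enn2real (T \<omega>)..S}. \<phi> (1 / \<kappa> u \<omega>)))
      else 0)"

(* The bound f r * \<epsilon> / (r * \<phi> (1 / r)) is a quotient in ennreal, since \<phi> (1 / r) = 0 is allowed:
   there a / 0 = \<infinity> for a > 0, and 0 / 0 = 0. *)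

end

theory Submission
  imports Defs
begin

text \<open>Write \<open>T\<close> for the first time \<open>\<kappa>\<close> exceeds \<open>R = 2 r / (1 - q)\<close>, and \<open>L\<close> for the first time it falls below
  \<open>l\<close>. At time \<open>T\<close> the process \<open>1 / \<kappa>\<close> is at most \<open>1 / R = (1 - q) / (2 r)\<close>. For \<open>\<kappa>\<close> to fall below \<open>r\<close>
  again, \<open>1 / \<kappa>\<close> has to rise to \<open>1 / r\<close>. Until then its compensator grows at rate at most \<open>\<phi> (1 / r)\<close>,
  since \<open>\<phi>\<close> is non-decreasing. Let \<open>t = \<epsilon> / (r \<phi> (1 / r))\<close>, so that the compensator contributes at
  most \<open>\<epsilon> / r\<close> up to time \<open>T + t\<close>. The supermartingale property then bounds the conditional probability,
  given the past of \<open>T\<close>, of a fall below \<open>r\<close> before \<open>T + t\<close> by \<open>(1 - q) / 2 + \<epsilon> \<le> 1 - q\<close>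
  (\<open>measure_no_early_drop\<close>). If \<open>T < L\<close> and there is no such fall, then \<open>\<kappa>\<close> is at least \<open>r\<close> on all
  of \<open>[T, T + t]\<close>, and this interval lies before \<open>L\<close> because \<open>l < r\<close>; hence the integral of \<open>f \<circ> \<kappa>\<close>
  up to \<open>L\<close> is at least \<open>t f r\<close> (\<open>stay_before_lower_time\<close>, \<open>integral_ge_of_stay\<close>).

  The conditional statement follows by integrating over the events \<open>A \<inter> {T < L}\<close> with \<open>A\<close> in \<open>F 0\<close>,
  which all belong to the past of \<open>T\<close> (\<open>cond_probability_mono\<close>). If \<open>\<phi> (1 / r) = 0\<close>, the
  argument works for every \<open>t\<close>, and the bound is the limit as \<open>t\<close> grows.

  What remains is measurability. Right-continuity of the paths and of the filtration makes the
  entry times into open sets stopping times (\<open>stopping_time_entry_time\<close>), and right-continuity of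
  the paths makes the integral a random variable (\<open>measurable_integral_up_to\<close>).\<close>

section \<open>Filtrations indexed by the half-line\<close>

lemma with_top_simps:
  shows with_top_infinity: "with_top M F \<infinity> = M"
    and with_top_ennreal: "0 \<le> t \<Longrightarrow> with_top M F (ennreal t) = F t"
  by (simp_all add: with_top_def)

lemma filtration_of_mono:
  assumes "filtration_of M F" "0 \<le> s" "s \<le> t"
  shows "sets (F s) \<subseteq> sets (F t)"
proof -
  interpret filtration "space M" "with_top M F"
    using assms(1) by (simp add: filtration_of_def)
  show ?thesis
    using sets_F_mono[of "ennreal s" "ennreal t"] assms by (simp add: with_top_simps ennreal_leI)
qed

lemma filtration_of_space:
  assumes "filtration_of M F" "0 \<le> t"
  shows "space (F t) = space M"
proof -
  interpret filtration "space M" "with_top M F"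
    using assms(1) by (simp add: filtration_of_def)
  show ?thesis
    using space_F[of "ennreal t"] assms by (simp add: with_top_simps)
qed

lemma filtration_of_subalgebra:
  assumes "filtration_of M F" "0 \<le> t"
  shows "subalgebra M (F t)"
proof -
  interpret filtration "space M" "with_top M F"
    using assms(1) by (simp add: filtration_of_def)
  show ?thesis
    using sets_F_mono[of "ennreal t" \<infinity>] assms
    unfolding with_top_infinity by (simp add: with_top_ennreal subalgebra_def filtration_of_space)
qed

section \<open>Entry times of right-continuous paths\<close>

definition entry_time :: "(real \<Rightarrow> real) \<Rightarrow> real set \<Rightarrow> ennreal" where
  "entry_time x U = Inf {ennreal s | s. 0 \<le> s \<and> x s \<in> U}"

lemma not_in_before_entry_time:
  assumes "0 \<le> s" "ennreal s < entry_time x U"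
  shows "x s \<notin> U"
proof
  assume "x s \<in> U"
  then have "entry_time x U \<le> ennreal s"
    unfolding entry_time_def using assms(1) by (intro Inf_lower) auto
  with assms(2) show False by simp
qed

lemma entry_time_less_iff:
  "entry_time x U < ennreal t \<longleftrightarrow> (\<exists>s. 0 \<le> s \<and> s < t \<and> x s \<in> U)"
proof -
  have "entry_time x U < ennreal t \<longleftrightarrow> (\<exists>s. 0 \<le> s \<and> x s \<in> U \<and> ennreal s < ennreal t)"
    unfolding entry_time_def Inf_less_iff by blast
  then show ?thesis
    using ennreal_less_iff by blast
qed

text \<open>A right-continuous path that sits in an open set at some time stays there for a short while,
  so rational times suffice to detect the entry; this makes an uncountable union countable.\<close>

lemma entry_time_less_iff_rational:
  assumes rc: "\<And>t. 0 \<le> t \<Longrightarrow> (x \<longlongrightarrow> x t) (at_right t)" and "open U"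
  shows "entry_time x U < ennreal t \<longleftrightarrow> (\<exists>s\<in>{s\<in>\<rat>. 0 \<le> s \<and> s < t}. x s \<in> U)"
proof
  assume "entry_time x U < ennreal t"
  then obtain s where s: "0 \<le> s" "s < t" "x s \<in> U"
    by (auto simp: entry_time_less_iff)
  have "eventually (\<lambda>u. x u \<in> U) (at_right s)"
    using rc[OF s(1)] \<open>open U\<close> s(3) by (rule topological_tendstoD)
  then obtain b where b: "b > s" "\<And>u. s < u \<Longrightarrow> u < b \<Longrightarrow> x u \<in> U"
    by (auto simp: eventually_at_right_field)
  obtain p where "p \<in> \<rat>" "s < p" "p < min b t"
    using Rats_dense_in_real[of s "min b t"] b s by auto
  then show "\<exists>s\<in>{s\<in>\<rat>. 0 \<le> s \<and> s < t}. x s \<in> U"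
    using b s by (intro bexI[of _ p]) auto
qed (auto simp: entry_time_less_iff)

text \<open>If the path were outside the closure at the entry time, then it would stay outside for a short
  while after it as well, and the entry time would be later.\<close>

lemma closure_at_entry_time:
  assumes rc: "(x \<longlongrightarrow> x t) (at_right t)" and "0 \<le> t" and t: "entry_time x U = ennreal t"
  shows "x t \<in> closure U"
proof (rule ccontr)
  assume *: "x t \<notin> closure U"
  then have "eventually (\<lambda>u. x u \<in> - closure U) (at_right t)"
    by (intro topological_tendstoD[OF rc]) auto
  then obtain b where b: "b > t" "\<And>u. t < u \<Longrightarrow> u < b \<Longrightarrow> x u \<in> - closure U"
    by (auto simp: eventually_at_right_field)
  have "entry_time x U < ennreal b"
    using b(1) \<open>0 \<le> t\<close> by (simp add: t ennreal_less_iff)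
  then obtain s where s: "0 \<le> s" "s < b" "x s \<in> U"
    by (auto simp: entry_time_less_iff)
  have "t \<le> s"
    using s t not_in_before_entry_time[of s x U] \<open>0 \<le> t\<close> by (force simp: ennreal_less_iff not_less)
  moreover have "x s \<in> closure U"
    using s closure_subset by blast
  ultimately show False
    using b(2)[of s] s * by (cases "s = t") auto
qed

text \<open>The path up to time \<open>u\<close> decides only whether the entry happens strictly before \<open>u\<close>. Right-continuity
  of the filtration turns this into the weak inequality that defines a stopping time.\<close>

lemma stopping_time_entry_time:
  assumes filt: "filtration_of M F" and rcF: "right_continuous_filtration F" and ad: "adapted F \<kappa>"
    and rc: "\<And>\<omega> t. \<omega> \<in> space M \<Longrightarrow> 0 \<le> t \<Longrightarrow> ((\<lambda>t. \<kappa> t \<omega>) \<longlongrightarrow> \<kappa> t \<omega>) (at_right t)"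
    and "open U"
  shows "stopping_time (with_top M F) (\<lambda>\<omega>. entry_time (\<lambda>t. \<kappa> t \<omega>) U)"
proof (rule stopping_timeI)
  fix t :: ennreal
  let ?T = "\<lambda>\<omega>. entry_time (\<lambda>t. \<kappa> t \<omega>) U"
  have less: "{\<omega> \<in> space M. ?T \<omega> < ennreal u} \<in> sets (F u)" if "0 \<le> u" for u
  proof -
    have "{\<omega> \<in> space M. ?T \<omega> < ennreal u}
        = (\<Union>s\<in>{s\<in>\<rat>. 0 \<le> s \<and> s < u}. {\<omega> \<in> space (F u). \<kappa> s \<omega> \<in> U})"
      using entry_time_less_iff_rational[OF rc \<open>open U\<close>] filtration_of_space[OF filt that] by auto
    also have "\<dots> \<in> sets (F u)"
    proof (intro sets.countable_UN'')
      show "countable {s \<in> \<rat>. 0 \<le> s \<and> s < u}"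
        using countable_rat by (rule countable_subset[rotated]) auto
      fix s assume s: "s \<in> {s \<in> \<rat>. 0 \<le> s \<and> s < u}"
      have "\<kappa> s -` U \<inter> space (F s) \<in> sets (F s)"
        using ad s \<open>open U\<close> by (intro measurable_sets[of _ _ borel]) (auto simp: adapted_def)
      moreover have "\<kappa> s -` U \<inter> space (F s) = {\<omega> \<in> space (F u). \<kappa> s \<omega> \<in> U}"
        using s that by (auto simp: filtration_of_space[OF filt])
      ultimately show "{\<omega> \<in> space (F u). \<kappa> s \<omega> \<in> U} \<in> sets (F u)"
        using filtration_of_mono[OF filt, of s u] s by auto
    qed
    finally show ?thesis .
  qed
  show "Measurable.pred (with_top M F t) (\<lambda>\<omega>. ?T \<omega> \<le> t)"
  proof (cases t)
    case top
    then show ?thesis by simp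
  next
    case (real u)
    have *: "{\<omega> \<in> space M. ?T \<omega> \<le> t} \<in> sets (F s)" if "u < s" for s
    proof -
      have eq: "{\<omega> \<in> space M. ?T \<omega> \<le> t}
          = (\<Inter>n\<in>UNIV. {\<omega> \<in> space M. ?T \<omega> < ennreal (u + (s - u) / real (Suc n))})"
      proof (intro set_eqI iffI INT_I, goal_cases)
        case (1 \<omega> n)
        have "t < ennreal (u + (s - u) / real (Suc n))"
          using real that by (auto simp: ennreal_less_iff)
        then show ?case
          using 1 by auto
      next
        case (2 \<omega>)
        have "(\<lambda>n. ennreal (u + (s - u) / real (Suc n))) \<longlonglongrightarrow> ennreal (u + 0)"
          by (intro tendsto_intros LIMSEQ_Suc[OF lim_const_over_n])
        moreover have "?T \<omega> \<le> ennreal (u + (s - u) / real (Suc n))" for n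
          using 2 by (auto intro: less_imp_le)
        ultimately have "?T \<omega> \<le> ennreal (u + 0)"
          by (intro LIMSEQ_le_const) auto
        then show ?case
          using 2 real by auto
      qed
      have "{\<omega> \<in> space M. ?T \<omega> < ennreal (u + (s - u) / real (Suc n))} \<in> sets (F s)" for n
      proof -
        have "(s - u) / real (Suc n) \<le> (s - u) / 1"
          using that by (intro divide_left_mono) auto
        then have "u + (s - u) / real (Suc n) \<le> s"
          by simp
        moreover have "0 \<le> u + (s - u) / real (Suc n)"
          using that real by simp
        ultimately show ?thesis
          using less filtration_of_mono[OF filt] by blast
      qed
      then show ?thesis
        unfolding eq by (intro sets.countable_INT) auto
    qed
    have "{\<omega> \<in> space M. ?T \<omega> \<le> t} \<in> sets (F u)"
    proof -
      have "sets (F u) = (\<Inter>s\<in>{u<..}. sets (F s))"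
        using rcF real by (simp only: right_continuous_filtration_def)
      with * show ?thesis by blast
    qed
    then show ?thesis
      using real by (simp add: with_top_simps pred_def filtration_of_space[OF filt])
  qed
qed

lemma upper_time_zero: "upper_time \<kappa> r (\<lambda>_. 0) \<omega> = entry_time (\<lambda>t. \<kappa> t \<omega>) {r<..}"
  by (simp add: upper_time_def entry_time_def)

lemma lower_time_zero: "lower_time \<kappa> l (\<lambda>_. 0) \<omega> = entry_time (\<lambda>t. \<kappa> t \<omega>) {..<l}"
  by (simp add: lower_time_def entry_time_def)

lemma lower_time_after:
  assumes "T \<omega> < \<infinity>"
  shows "lower_time \<kappa> l T \<omega> = T \<omega> + entry_time (\<lambda>s. \<kappa> (enn2real (T \<omega>) + s) \<omega>) {..<l}"
  using assms by (simp add: lower_time_def entry_time_def)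

section \<open>Joint measurability\<close>

text \<open>Evaluating at the next point of a grid of mesh \<open>1 / (n + 1)\<close> gives a jointly measurable function,
  because the grid is countable; right-continuity makes these functions converge as the mesh shrinks.\<close>

lemma right_continuous_jointly_measurable:
  fixes \<kappa> :: "real \<Rightarrow> 'a \<Rightarrow> real"
  assumes meas: "\<And>t. 0 \<le> t \<Longrightarrow> \<kappa> t \<in> borel_measurable M"
    and rc: "\<And>\<omega> t. \<omega> \<in> space M \<Longrightarrow> 0 \<le> t \<Longrightarrow> ((\<lambda>t. \<kappa> t \<omega>) \<longlongrightarrow> \<kappa> t \<omega>) (at_right t)"
  shows "(\<lambda>(\<omega>, s). \<kappa> (max 0 s) \<omega>) \<in> borel_measurable (M \<Otimes>\<^sub>M lborel)"
proof -
  let ?g = "\<lambda>n s. real_of_int (max 0 \<lfloor>real (Suc n) * max 0 s\<rfloor> + 1) / real (Suc n)"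
  have lim: "(\<lambda>n. case x of (\<omega>, s) \<Rightarrow> \<kappa> (?g n s) \<omega>) \<longlonglongrightarrow> (case x of (\<omega>, s) \<Rightarrow> \<kappa> (max 0 s) \<omega>)"
    if x: "x \<in> space (M \<Otimes>\<^sub>M lborel)" for x
  proof -
    obtain \<omega> s where xe: "x = (\<omega>, s)" and \<omega>: "\<omega> \<in> space M"
      using x by (auto simp: space_pair_measure)
    define u where "u = max 0 s"
    have u: "0 \<le> u" by (simp add: u_def)
    have g: "?g n s = real_of_int (\<lfloor>real (Suc n) * u\<rfloor> + 1) / real (Suc n)" for n
      using u by (simp add: u_def[symmetric])
    have lower: "u < ?g n s" for n
    proof -
      have "real (Suc n) * u < real_of_int (\<lfloor>real (Suc n) * u\<rfloor> + 1)"
        by linarith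
      then show ?thesis
        unfolding g by (simp add: less_divide_eq mult.commute)
    qed
    have upper: "?g n s \<le> u + 1 / real (Suc n)" for n
    proof -
      have "real_of_int (\<lfloor>real (Suc n) * u\<rfloor> + 1) \<le> real (Suc n) * u + 1"
        by linarith
      then have "?g n s \<le> (real (Suc n) * u + 1) / real (Suc n)"
        unfolding g by (rule divide_right_mono) simp
      also have "\<dots> = u + 1 / real (Suc n)"
        by (simp add: add_divide_distrib)
      finally show ?thesis .
    qed
    have "(\<lambda>n. u + 1 / real (Suc n)) \<longlonglongrightarrow> u + 0"
      by (intro tendsto_intros LIMSEQ_Suc[OF lim_const_over_n])
    then have *: "(\<lambda>n. u + 1 / real (Suc n)) \<longlonglongrightarrow> u"
      by simp
    have "(\<lambda>n. ?g n s) \<longlonglongrightarrow> u"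
    proof (rule tendsto_sandwich[OF _ _ tendsto_const *])
      show "\<forall>\<^sub>F n in sequentially. u \<le> ?g n s"
        by (intro always_eventually allI less_imp_le lower)
      show "\<forall>\<^sub>F n in sequentially. ?g n s \<le> u + 1 / real (Suc n)"
        by (intro always_eventually allI upper)
    qed
    then have "filterlim (\<lambda>n. ?g n s) (at_right u) sequentially"
      using lower by (auto simp: filterlim_at intro!: always_eventually)
    from filterlim_compose[OF rc[OF \<omega> u] this] show ?thesis
      by (simp add: xe u_def)
  qed
  have meas_grid: "(\<lambda>x. case x of (\<omega>, s) \<Rightarrow> \<kappa> (?g n s) \<omega>) \<in> borel_measurable (M \<Otimes>\<^sub>M lborel)" for n
  proof -
    let ?\<kappa> = "\<lambda>k x. \<kappa> (real_of_int (max 0 k + 1) / real (Suc n)) (fst x)"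
    have "(\<lambda>x. ?\<kappa> \<lfloor>real (Suc n) * max 0 (snd x)\<rfloor> x) \<in> borel_measurable (M \<Otimes>\<^sub>M lborel)"
    proof (rule measurable_compose_countable[where f = "?\<kappa>"])
      show "?\<kappa> k \<in> borel_measurable (M \<Otimes>\<^sub>M lborel)" for k
        by (rule measurable_compose[OF measurable_fst meas]) auto
    qed measurable
    then show ?thesis
      by (simp add: case_prod_beta')
  qed
  show ?thesis
    using lim meas_grid by (rule borel_measurable_LIMSEQ_real)
qed

lemma measurable_integral_up_to:
  fixes \<kappa> :: "real \<Rightarrow> 'a \<Rightarrow> real" and f :: "real \<Rightarrow> real"
  assumes meas: "\<And>t. 0 \<le> t \<Longrightarrow> \<kappa> t \<in> borel_measurable M"
    and rc: "\<And>\<omega> t. \<omega> \<in> space M \<Longrightarrow> 0 \<le> t \<Longrightarrow> ((\<lambda>t. \<kappa> t \<omega>) \<longlongrightarrow> \<kappa> t \<omega>) (at_right t)"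
    and nonneg: "\<And>\<omega> t. \<omega> \<in> space M \<Longrightarrow> 0 \<le> t \<Longrightarrow> 0 \<le> \<kappa> t \<omega>"
    and mono: "mono_on {0..} f"
    and T[measurable]: "T \<in> borel_measurable M"
  shows "(\<lambda>\<omega>. \<integral>\<^sup>+ s \<in> {s. 0 \<le> s \<and> ennreal s \<le> T \<omega>}. ennreal (f (\<kappa> s \<omega>)) \<partial>lborel)
    \<in> borel_measurable M"
proof -
  have "mono (\<lambda>x. f (max 0 x))"
    using mono by (auto simp: mono_on_def mono_def)
  then have [measurable]: "(\<lambda>x. f (max 0 x)) \<in> borel_measurable borel"
    by (rule borel_measurable_mono)
  have [measurable]: "(\<lambda>x. \<kappa> (max 0 (snd x)) (fst x)) \<in> borel_measurable (M \<Otimes>\<^sub>M lborel)"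
    using right_continuous_jointly_measurable[OF meas rc] by (simp add: case_prod_beta')
  have "(\<lambda>x. ennreal ((\<lambda>y. f (max 0 y)) (\<kappa> (max 0 (snd x)) (fst x))) *
      indicator {x \<in> space (M \<Otimes>\<^sub>M lborel). 0 \<le> snd x \<and> ennreal (snd x) \<le> T (fst x)} x)
      \<in> borel_measurable (M \<Otimes>\<^sub>M lborel)"
    by measurable
  then have "(\<lambda>(\<omega>, s). ennreal ((\<lambda>y. f (max 0 y)) (\<kappa> (max 0 s) \<omega>)) *
      indicator {x \<in> space (M \<Otimes>\<^sub>M lborel). 0 \<le> snd x \<and> ennreal (snd x) \<le> T (fst x)} (\<omega>, s))
      \<in> borel_measurable (M \<Otimes>\<^sub>M lborel)"
    by (simp add: case_prod_beta')
  from lborel.borel_measurable_nn_integral[OF this] show ?thesis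
  proof (rule measurable_cong[THEN iffD1, rotated])
    fix \<omega> assume "\<omega> \<in> space M"
    then show "(\<integral>\<^sup>+ s. ennreal (f (max 0 (\<kappa> (max 0 s) \<omega>))) *
        indicator {x \<in> space (M \<Otimes>\<^sub>M lborel). 0 \<le> snd x \<and> ennreal (snd x) \<le> T (fst x)} (\<omega>, s) \<partial>lborel)
      = (\<integral>\<^sup>+ s \<in> {s. 0 \<le> s \<and> ennreal s \<le> T \<omega>}. ennreal (f (\<kappa> s \<omega>)) \<partial>lborel)"
      using nonneg
      by (intro nn_integral_cong) (auto simp: indicator_def space_pair_measure max_absorb2)
  qed
qed

section \<open>Comparing conditional probabilities\<close>

text \<open>The set where the inequality fails belongs to \<open>F\<close>, so the hypothesis can be used on it.\<close>

lemma (in sigma_finite_subalgebra) real_cond_exp_mono_intA: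
  assumes [measurable]: "integrable M f" "integrable M g"
    and le: "\<And>A. A \<in> sets F \<Longrightarrow> (\<integral>x\<in>A. f x \<partial>M) \<le> (\<integral>x\<in>A. g x \<partial>M)"
  shows "AE x in M. real_cond_exp M F f x \<le> real_cond_exp M F g x"
proof -
  let ?h = "\<lambda>x. real_cond_exp M F f x - real_cond_exp M F g x"
  define A where "A = {x \<in> space F. real_cond_exp M F g x < real_cond_exp M F f x}"
  have A: "A \<in> sets F" unfolding A_def by measurable
  then have AM: "A \<in> sets M" and spF: "space F = space M"
    using subalg by (auto simp: subalgebra_def)
  have int: "integrable M (real_cond_exp M F f)" "integrable M (real_cond_exp M F g)"
    using assms by (auto intro: real_cond_exp_int)
  have si: "set_integrable M A (real_cond_exp M F f)" "set_integrable M A (real_cond_exp M F g)"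
    unfolding set_integrable_def using int AM by (auto intro!: integrable_mult_indicator simp del: real_scaleR_def)
  have "(\<integral>x\<in>A. ?h x \<partial>M) = (\<integral>x\<in>A. f x \<partial>M) - (\<integral>x\<in>A. g x \<partial>M)"
    using si A assms(1,2) by (simp add: set_integral_diff real_cond_exp_intA)
  then have "(\<integral>x. indicator A x * ?h x \<partial>M) \<le> 0"
    using le[OF A] by (simp add: set_lebesgue_integral_def)
  moreover have nonneg: "0 \<le> indicator A x * ?h x" for x
    by (auto simp: A_def indicator_def)
  moreover have int_h: "integrable M (\<lambda>x. indicator A x * ?h x)"
    using int AM integrable_mult_indicator[of A M ?h] by simp
  ultimately have "(\<integral>x. indicator A x * ?h x \<partial>M) = 0"
    by (intro antisym integral_nonneg) auto
  then have "AE x in M. indicator A x * ?h x = 0"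
    using integral_nonneg_eq_0_iff_AE[OF int_h] nonneg by simp
  then show ?thesis
    by (rule AE_mp) (auto simp: A_def spF indicator_def split: if_splits intro!: AE_I2)
qed

lemma (in prob_space) cond_probability_mono:
  assumes sub: "subalgebra M G"
    and meas: "{\<omega> \<in> space M. P \<omega>} \<in> sets M" "{\<omega> \<in> space M. Q \<omega>} \<in> sets M"
    and le: "\<And>A. A \<in> sets G \<Longrightarrow>
      c * measure M (A \<inter> {\<omega> \<in> space M. P \<omega>}) \<le> measure M (A \<inter> {\<omega> \<in> space M. Q \<omega>})"
  shows "AE \<omega> in M. c * cond_probability M G P \<omega> \<le> cond_probability M G Q \<omega>"
proof -
  interpret sigma_finite_subalgebra M G
    using sub by (intro finite_measure_subalgebra_is_sigma_finite) unfold_locales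
  have int: "integrable M (indicator {\<omega> \<in> space M. P \<omega>} :: _ \<Rightarrow> real)"
      "integrable M (indicator {\<omega> \<in> space M. Q \<omega>} :: _ \<Rightarrow> real)"
    using meas by (auto intro!: integrable_real_indicator simp: emeasure_eq_measure)
  have eq: "(\<integral>x\<in>A. indicator S x \<partial>M) = measure M (A \<inter> S)"
    if "A \<in> sets G" "S \<in> sets M" for A S
  proof -
    have "A \<inter> S \<in> sets M"
      using that sub by (auto simp: subalgebra_def)
    moreover have "(\<integral>x\<in>A. indicator S x \<partial>M) = (\<integral>x. (indicator (A \<inter> S) x :: real) \<partial>M)"
      unfolding set_lebesgue_integral_def by (intro Bochner_Integration.integral_cong) (auto simp: indicator_def)
    ultimately show ?thesis
      by (simp add: sets.Int_space_eq2 del: Int_iff)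
  qed
  have "AE \<omega> in M. real_cond_exp M G (\<lambda>\<omega>. c * indicator {\<omega> \<in> space M. P \<omega>} \<omega>) \<omega>
      \<le> real_cond_exp M G (indicator {\<omega> \<in> space M. Q \<omega>}) \<omega>"
  proof (rule real_cond_exp_mono_intA)
    fix A assume "A \<in> sets G"
    then show "(\<integral>x\<in>A. c * indicator {\<omega> \<in> space M. P \<omega>} x \<partial>M)
        \<le> (\<integral>x\<in>A. indicator {\<omega> \<in> space M. Q \<omega>} x \<partial>M)"
      using le[of A] meas by (simp only: set_integral_mult_right eq)
  qed (use int in \<open>auto intro: integrable_mult_right\<close>)
  moreover have "AE \<omega> in M. real_cond_exp M G (\<lambda>\<omega>. c * indicator {\<omega> \<in> space M. P \<omega>} \<omega>) \<omega>
      = c * cond_probability M G P \<omega>"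
    unfolding cond_probability_def by (rule real_cond_exp_cmult[OF int(1)])
  ultimately show ?thesis
    unfolding cond_probability_def by eventually_elim simp
qed

lemma supermartingale_set_integral_le:
  assumes "prob_space M" and sm: "supermartingale M G X" and "0 \<le> s" "s \<le> t" and B: "B \<in> sets (G s)"
  shows "(\<integral>\<omega>\<in>B. X t \<omega> \<partial>M) \<le> (\<integral>\<omega>\<in>B. X s \<omega> \<partial>M)"
proof -
  interpret prob_space M by fact
  have filt: "filtration_of M G" and int: "integrable M (X t)" "integrable M (X s)"
    and le: "AE \<omega> in M. real_cond_exp M (G s) (X t) \<omega> \<le> X s \<omega>"
    using sm \<open>0 \<le> s\<close> \<open>s \<le> t\<close> by (auto simp: supermartingale_def)
  have sub: "subalgebra M (G s)"
    using filt \<open>0 \<le> s\<close> by (rule filtration_of_subalgebra)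
  interpret sigma_finite_subalgebra M "G s"
    using sub by (intro finite_measure_subalgebra_is_sigma_finite) unfold_locales
  have BM: "B \<in> sets M"
    using sub B by (auto simp: subalgebra_def)
  have "(\<integral>\<omega>\<in>B. X t \<omega> \<partial>M) = (\<integral>\<omega>\<in>B. real_cond_exp M (G s) (X t) \<omega> \<partial>M)"
    using int B by (intro real_cond_exp_intA)
  also have "\<dots> \<le> (\<integral>\<omega>\<in>B. X s \<omega> \<partial>M)"
    unfolding set_lebesgue_integral_def using le int BM
    by (intro integral_mono_AE integrable_mult_indicator real_cond_exp_int)
       (auto simp: indicator_def)
  finally show ?thesis .
qed

section \<open>The compensated inverse process\<close>

lemma compensated_inverse_at_zero:
  assumes "T \<omega> < \<infinity>"
  shows "compensated_inverse \<kappa> \<phi> r T 0 \<omega> = 1 / \<kappa> (enn2real (T \<omega>)) \<omega>"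
proof -
  have "T \<omega> \<le> lower_time \<kappa> r T \<omega>"
    by (simp add: lower_time_def)
  then have "min (T \<omega> + ennreal 0) (lower_time \<kappa> r T \<omega>) = T \<omega>"
    by (simp add: min_def)
  moreover have "(LBINT u:{a..a}. g u) = 0" for a :: real and g :: "real \<Rightarrow> real"
    unfolding set_lebesgue_integral_def
  proof (rule integral_eq_zero_AE)
    show "AE u in lborel. indicator {a..a} u *\<^sub>R g u = 0"
      using AE_lborel_singleton[of a] by eventually_elim auto
  qed
  ultimately show ?thesis
    using assms by (simp add: compensated_inverse_def Let_def)
qed

text \<open>Before \<open>\<kappa>\<close> falls below \<open>r\<close>, the integrand is at most \<open>\<phi> (1 / r)\<close>, since \<open>\<phi>\<close> is
  non-decreasing; the single end point of the interval is a null set. At the time of the fall,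
  \<open>1 / \<kappa>\<close> has reached \<open>1 / r\<close> by right-continuity, whether or not there is a jump.\<close>

lemma compensated_inverse_ge:
  assumes rc: "\<And>t. 0 \<le> t \<Longrightarrow> ((\<lambda>t. \<kappa> t \<omega>) \<longlongrightarrow> \<kappa> t \<omega>) (at_right t)"
    and ge1: "\<And>t. 0 \<le> t \<Longrightarrow> 1 \<le> \<kappa> t \<omega>"
    and mono: "mono_on {0<..1} \<phi>" and nonneg: "\<And>x. x \<in> {0<..1} \<Longrightarrow> 0 \<le> \<phi> x"
    and "1 \<le> r" and fin: "T \<omega> < \<infinity>" and "0 \<le> t"
  shows "(if lower_time \<kappa> r T \<omega> \<le> T \<omega> + ennreal t then 1 / r else 0) - t * \<phi> (1 / r)
    \<le> compensated_inverse \<kappa> \<phi> r T t \<omega>"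
proof -
  define a where "a = enn2real (T \<omega>)"
  have Ta: "T \<omega> = ennreal a" and a: "0 \<le> a"
    using fin by (auto simp: a_def)
  define \<sigma> where "\<sigma> = entry_time (\<lambda>s. \<kappa> (a + s) \<omega>) {..<r}"
  define d where "d = enn2real (min (ennreal t) \<sigma>)"
  have \<sigma>: "lower_time \<kappa> r T \<omega> = ennreal a + \<sigma>"
    using lower_time_after[where T = T and \<omega> = \<omega>, OF fin] by (simp add: \<sigma>_def a_def[symmetric] Ta[symmetric])
  have d: "ennreal d = min (ennreal t) \<sigma>"
    unfolding d_def by (intro ennreal_enn2real) (simp add: min_less_iff_disj)
  have d0: "0 \<le> d" by (simp add: d_def)
  have "ennreal d \<le> ennreal t"
    by (simp add: d)
  then have dt: "d \<le> t"
    using \<open>0 \<le> t\<close> by simp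
  have "min (T \<omega> + ennreal t) (lower_time \<kappa> r T \<omega>) = ennreal (a + d)"
    unfolding \<sigma> Ta using a d0 by (simp add: d min_def ennreal_add_left_cancel_le)
  then have S: "enn2real (min (T \<omega> + ennreal t) (lower_time \<kappa> r T \<omega>)) = a + d"
    using a d0 by (simp del: ennreal_plus)
  have r: "1 / r \<in> {0<..1}"
    using \<open>1 \<le> r\<close> by simp
  have bound: "\<phi> (1 / \<kappa> u \<omega>) \<le> \<phi> (1 / r)" if "a \<le> u" "u < a + d" for u
  proof -
    have "ennreal (u - a) < ennreal d"
      using that by (simp add: ennreal_less_iff)
    then have "ennreal (u - a) < \<sigma>"
      by (simp add: d)
    then have "r \<le> \<kappa> u \<omega>"
      using not_in_before_entry_time[of "u - a"] that by (fastforce simp: \<sigma>_def)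
    then show ?thesis
      using \<open>1 \<le> r\<close> by (intro mono_onD[OF mono]) (auto simp: frac_le)
  qed
  have "(LBINT u:{a..a + d}. \<phi> (1 / \<kappa> u \<omega>)) \<le> (LBINT u:{a..a + d}. \<phi> (1 / r))"
    unfolding set_lebesgue_integral_def
  proof (rule integral_mono_AE')
    show "AE u in lborel. indicator {a..a + d} u *\<^sub>R \<phi> (1 / \<kappa> u \<omega>)
        \<le> indicator {a..a + d} u *\<^sub>R \<phi> (1 / r)"
      using AE_lborel_singleton[of "a + d"]
      by eventually_elim (use bound in \<open>auto simp: indicator_def\<close>)
    show "AE u in lborel. 0 \<le> indicator {a..a + d} u *\<^sub>R \<phi> (1 / r)"
      using nonneg[OF r] by auto
    show "integrable lborel (\<lambda>u. indicator {a..a + d} u *\<^sub>R \<phi> (1 / r))"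
      by (intro integrable_scaleR_left integrable_real_indicator) (auto simp: emeasure_lborel_Icc_eq)
  qed
  also have "\<dots> = d * \<phi> (1 / r)"
    using d0 by (simp add: set_lebesgue_integral_def)
  also have "\<dots> \<le> t * \<phi> (1 / r)"
    using dt nonneg[OF r] by (rule mult_right_mono)
  finally have integral: "(LBINT u:{a..a + d}. \<phi> (1 / \<kappa> u \<omega>)) \<le> t * \<phi> (1 / r)" .
  have "1 / r \<le> 1 / \<kappa> (a + d) \<omega>" if "lower_time \<kappa> r T \<omega> \<le> T \<omega> + ennreal t"
  proof -
    have "\<sigma> \<le> ennreal t"
      using that by (simp add: \<sigma> Ta ennreal_add_left_cancel_le)
    then have "\<sigma> = ennreal d"
      by (simp add: d min_absorb2)
    moreover have "((\<lambda>s. \<kappa> (a + s) \<omega>) \<longlongrightarrow> \<kappa> (a + d) \<omega>) (at_right d)"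
    proof (rule filterlim_compose[OF rc])
      show "filterlim (\<lambda>s. a + s) (at_right (a + d)) (at_right d)"
        unfolding filterlim_at
        by (auto intro!: tendsto_intros eventually_mono[OF eventually_at_right_less])
    qed (use a d0 in simp)
    ultimately have "\<kappa> (a + d) \<omega> \<in> closure {..<r}"
      using d0 unfolding \<sigma>_def by (intro closure_at_entry_time)
    then have "\<kappa> (a + d) \<omega> \<le> r"
      by simp
    then show ?thesis
      using ge1[of "a + d"] a d0 by (intro frac_le) auto
  qed
  moreover have "0 \<le> 1 / \<kappa> (a + d) \<omega>"
    using ge1[of "a + d"] a d0 by simp
  moreover have "compensated_inverse \<kappa> \<phi> r T t \<omega>
      = 1 / \<kappa> (a + d) \<omega> - (LBINT u:{a..a + d}. \<phi> (1 / \<kappa> u \<omega>))"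
    using fin by (simp add: compensated_inverse_def S Let_def a_def[symmetric])
  ultimately show ?thesis
    using integral by (cases "lower_time \<kappa> r T \<omega> \<le> T \<omega> + ennreal t"; simp only: if_True if_False; linarith)
qed

text \<open>On \<open>B\<close> the process starts at \<open>p / r\<close> or less. At time \<open>t\<close> it is at least \<open>(1 - e) / r\<close> if \<open>\<kappa>\<close>
  has dropped below \<open>r\<close> by then, and at least \<open>- e / r\<close> otherwise. Its integral over \<open>B\<close> does not
  increase, so a drop happens on at most the fraction \<open>p + e\<close> of \<open>B\<close>. The set \<open>D\<close> only has to
  contain the outcomes in \<open>B\<close> without a drop; this lets \<open>D\<close> be an event whose measurability is
  already known.\<close>

lemma measure_no_early_drop:
  assumes "prob_space M" and sm: "supermartingale M G (compensated_inverse \<kappa> \<phi> r T)"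
    and rc: "\<And>\<omega> t. \<omega> \<in> space M \<Longrightarrow> 0 \<le> t \<Longrightarrow> ((\<lambda>t. \<kappa> t \<omega>) \<longlongrightarrow> \<kappa> t \<omega>) (at_right t)"
    and ge1: "\<And>\<omega> t. \<omega> \<in> space M \<Longrightarrow> 0 \<le> t \<Longrightarrow> 1 \<le> \<kappa> t \<omega>"
    and mono: "mono_on {0<..1} \<phi>" and nonneg: "\<And>x. x \<in> {0<..1} \<Longrightarrow> 0 \<le> \<phi> x"
    and "1 \<le> r" and "0 \<le> t" and e: "t * \<phi> (1 / r) \<le> e / r"
    and B: "B \<in> sets (G 0)" and fin: "\<And>\<omega>. \<omega> \<in> B \<Longrightarrow> T \<omega> < \<infinity>"
    and start: "\<And>\<omega>. \<omega> \<in> B \<Longrightarrow> 1 / \<kappa> (enn2real (T \<omega>)) \<omega> \<le> p / r"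
    and D: "D \<in> sets M"
    and drop: "\<And>\<omega>. \<omega> \<in> B \<Longrightarrow> \<omega> \<notin> D \<Longrightarrow> lower_time \<kappa> r T \<omega> \<le> T \<omega> + ennreal t"
  shows "(1 - p - e) * measure M B \<le> measure M (B \<inter> D)"
proof -
  interpret prob_space M by fact
  let ?X = "compensated_inverse \<kappa> \<phi> r T"
  have BM: "B \<in> sets M"
    using sm B filtration_of_subalgebra[of M G 0] by (auto simp: supermartingale_def subalgebra_def)
  then have Bsp: "\<omega> \<in> space M" if "\<omega> \<in> B" for \<omega>
    using that sets.sets_into_space by blast
  have int: "integrable M (?X t)" "integrable M (?X 0)"
    using sm \<open>0 \<le> t\<close> by (auto simp: supermartingale_def)
  have si: "integrable M (\<lambda>\<omega>. indicator B \<omega> * ?X t \<omega>)" "integrable M (\<lambda>\<omega>. indicator B \<omega> * ?X 0 \<omega>)"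
    using int BM integrable_mult_indicator[of B M "?X t"] integrable_mult_indicator[of B M "?X 0"]
    by simp_all
  have "(\<integral>\<omega>. (1 - e) / r * indicator B \<omega> - 1 / r * indicator (B \<inter> D) \<omega> \<partial>M)
      \<le> (\<integral>\<omega>\<in>B. ?X t \<omega> \<partial>M)"
    unfolding set_lebesgue_integral_def real_scaleR_def
  proof (rule integral_mono[OF _ si(1)])
    fix \<omega> assume "\<omega> \<in> space M"
    have "(1 - e) / r - 1 / r * indicator D \<omega> \<le> ?X t \<omega>" if \<omega>: "\<omega> \<in> B"
    proof -
      have "(if lower_time \<kappa> r T \<omega> \<le> T \<omega> + ennreal t then 1 / r else 0) - t * \<phi> (1 / r) \<le> ?X t \<omega>"
        using compensated_inverse_ge[where \<omega> = \<omega> and T = T, OF _ _ mono nonneg \<open>1 \<le> r\<close> fin[OF \<omega>] \<open>0 \<le> t\<close>]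
          rc[OF Bsp[OF \<omega>]] ge1[OF Bsp[OF \<omega>]] by blast
      moreover have "1 / r * (1 - indicator D \<omega>)
          \<le> (if lower_time \<kappa> r T \<omega> \<le> T \<omega> + ennreal t then 1 / r else 0)"
        using drop[OF \<omega>] \<open>1 \<le> r\<close> by (auto simp: indicator_def)
      ultimately show ?thesis
        using e by (simp add: diff_divide_distrib right_diff_distrib)
    qed
    then show "(1 - e) / r * indicator B \<omega> - 1 / r * indicator (B \<inter> D) \<omega> \<le> indicator B \<omega> * ?X t \<omega>"
      by (auto simp: indicator_def)
  qed (use BM D in \<open>auto intro!: Bochner_Integration.integrable_diff integrable_real_indicator
        simp: emeasure_eq_measure\<close>)
  also have "\<dots> \<le> (\<integral>\<omega>\<in>B. ?X 0 \<omega> \<partial>M)"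
    using \<open>prob_space M\<close> sm \<open>0 \<le> t\<close> B by (intro supermartingale_set_integral_le[where G = G]) auto
  also have "\<dots> \<le> (\<integral>\<omega>. p / r * indicator B \<omega> \<partial>M)"
    unfolding set_lebesgue_integral_def real_scaleR_def
  proof (rule integral_mono[OF si(2)])
    show "indicator B \<omega> * ?X 0 \<omega> \<le> p / r * indicator B \<omega>" for \<omega>
      using compensated_inverse_at_zero[where T = T and \<omega> = \<omega>] fin start by (auto simp: indicator_def)
  qed (use BM in \<open>auto intro!: integrable_real_indicator simp: emeasure_eq_measure\<close>)
  finally have "(1 - e) / r * measure M B - 1 / r * measure M (B \<inter> D) \<le> p / r * measure M B"
    using BM D by (subst (asm) Bochner_Integration.integral_diff)
      (auto intro!: integrable_real_indicator simp: emeasure_eq_measure sets.Int_space_eq2)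
  then have "((1 - e) * measure M B - measure M (B \<inter> D)) / r \<le> (p * measure M B) / r"
    by (simp add: diff_divide_distrib left_diff_distrib)
  then have "(1 - e) * measure M B - measure M (B \<inter> D) \<le> p * measure M B"
    using \<open>1 \<le> r\<close> by (simp add: divide_le_cancel)
  then show ?thesis
    by (simp add: algebra_simps)
qed

section \<open>A long stay above a level\<close>

lemma integral_ge_of_stay:
  fixes f x :: "real \<Rightarrow> real"
  assumes f: "mono_on {0..} f" and "0 \<le> r" "0 \<le> a" "0 \<le> t"
    and stay: "\<And>s. a \<le> s \<Longrightarrow> s \<le> a + t \<Longrightarrow> r \<le> x s" and L: "ennreal (a + t) \<le> L" and "0 \<le> f r"
  shows "ennreal (f r * t) \<le> (\<integral>\<^sup>+ s \<in> {s. 0 \<le> s \<and> ennreal s \<le> L}. ennreal (f (x s)) \<partial>lborel)"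
proof -
  have "ennreal (f r * t) = (\<integral>\<^sup>+ s. ennreal (f r) * indicator {a..a + t} s \<partial>lborel)"
    using assms by (simp add: nn_integral_cmult_indicator ennreal_mult)
  also have "\<dots> \<le> (\<integral>\<^sup>+ s \<in> {s. 0 \<le> s \<and> ennreal s \<le> L}. ennreal (f (x s)) \<partial>lborel)"
  proof (rule nn_integral_mono)
    fix s :: real
    have "ennreal (f r) \<le> ennreal (f (x s)) \<and> 0 \<le> s \<and> ennreal s \<le> L" if s: "a \<le> s" "s \<le> a + t"
    proof (intro conjI)
      show "ennreal (f r) \<le> ennreal (f (x s))"
        using stay[OF s] \<open>0 \<le> r\<close> by (intro ennreal_leI mono_onD[OF f]) auto
      show "ennreal s \<le> L"
        using s L by (meson ennreal_leI order_trans)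
    qed (use s \<open>0 \<le> a\<close> in simp)
    then show "ennreal (f r) * indicator {a..a + t} s
        \<le> ennreal (f (x s)) * indicator {s. 0 \<le> s \<and> ennreal s \<le> L} s"
      by (auto simp: indicator_def)
  qed
  finally show ?thesis .
qed

text \<open>The path stays at \<open>r\<close> or above throughout \<open>[T, T + t]\<close>, and it has not been below \<open>l\<close> up to \<open>T\<close>.
  Since \<open>l < r\<close>, it first falls below \<open>l\<close> only after \<open>T + t\<close>.\<close>

lemma stay_before_lower_time:
  assumes "l < r" and T: "T \<omega> < lower_time \<kappa> l (\<lambda>_. 0) \<omega>" and "0 \<le> t"
    and low: "T \<omega> + ennreal t < lower_time \<kappa> r T \<omega>"
  shows "ennreal (enn2real (T \<omega>) + t) \<le> lower_time \<kappa> l (\<lambda>_. 0) \<omega>"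
    and "enn2real (T \<omega>) \<le> s \<Longrightarrow> s \<le> enn2real (T \<omega>) + t \<Longrightarrow> r \<le> \<kappa> s \<omega>"
proof -
  define a where "a = enn2real (T \<omega>)"
  have fin: "T \<omega> < \<infinity>"
    using T by (auto simp: less_top[symmetric])
  then have Ta: "T \<omega> = ennreal a" and a: "0 \<le> a"
    by (auto simp: a_def)
  have t: "ennreal t < entry_time (\<lambda>s. \<kappa> (a + s) \<omega>) {..<r}"
    using low lower_time_after[where T = T and \<omega> = \<omega>, OF fin]
    by (simp add: Ta a ennreal_add_left_cancel_less)
  have stay: "r \<le> \<kappa> s \<omega>" if "a \<le> s" "s \<le> a + t" for s
  proof -
    have "ennreal (s - a) \<le> ennreal t"
      using that by (intro ennreal_leI) simp
    then have "ennreal (s - a) < entry_time (\<lambda>s. \<kappa> (a + s) \<omega>) {..<r}"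
      using t by (rule le_less_trans)
    from not_in_before_entry_time[OF _ this] show ?thesis
      using that by (simp add: not_less)
  qed
  then show "enn2real (T \<omega>) \<le> s \<Longrightarrow> s \<le> enn2real (T \<omega>) + t \<Longrightarrow> r \<le> \<kappa> s \<omega>"
    by (simp add: a_def)
  show "ennreal (enn2real (T \<omega>) + t) \<le> lower_time \<kappa> l (\<lambda>_. 0) \<omega>"
  proof (rule ccontr)
    assume "\<not> ?thesis"
    then have "entry_time (\<lambda>t. \<kappa> t \<omega>) {..<l} < ennreal (a + t)"
      by (simp add: lower_time_zero a_def not_le)
    then obtain s where s: "0 \<le> s" "s < a + t" "\<kappa> s \<omega> < l"
      by (auto simp: entry_time_less_iff)
    then have "s < a"
      using stay[of s] \<open>l < r\<close> by (cases "a \<le> s") auto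
    then have "ennreal s < entry_time (\<lambda>t. \<kappa> t \<omega>) {..<l}"
      using T \<open>0 \<le> s\<close> by (simp add: lower_time_zero Ta) (meson ennreal_less_iff less_trans)
    from not_in_before_entry_time[OF \<open>0 \<le> s\<close> this] show False
      using s by simp
  qed
qed

theorem lemma4p2:
  fixes M :: "'a measure"
    and F :: "real \<Rightarrow> 'a measure"
    and \<kappa> :: "real \<Rightarrow> 'a \<Rightarrow> real"
    and \<phi> f :: "real \<Rightarrow> real"
    and l q \<epsilon> r :: real
  assumes "prob_space M"
    and "filtration_of M F"
    and "right_continuous_filtration F"
    and "adapted F \<kappa>"
    and "\<And>t \<omega>. 0 \<le> t \<Longrightarrow> \<omega> \<in> space M \<Longrightarrow> 1 \<le> \<kappa> t \<omega>"
    and "\<And>\<omega>. \<omega> \<in> space M \<Longrightarrow> cadlag (\<lambda>t. \<kappa> t \<omega>)"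
    and "AE \<omega> in M. Limsup at_top (\<lambda>t. ereal (\<kappa> t \<omega>)) = \<infinity>"
    and "1 < l"
    and "continuous_on {0<..1} \<phi>"
    and "mono_on {0<..1} \<phi>"
    and "\<And>x. x \<in> {0<..1} \<Longrightarrow> 0 \<le> \<phi> x"
    and "\<And>q r. 0 < q \<Longrightarrow> q < 1 \<Longrightarrow> l < r \<Longrightarrow>
           (let \<rho> = upper_time \<kappa> (2 * r / (1 - q)) (\<lambda>_. 0) in
            supermartingale M (\<lambda>t. stopped_sigma M F (\<lambda>\<omega>. \<rho> \<omega> + ennreal t))
              (compensated_inverse \<kappa> \<phi> r \<rho>))"
    and "0 < q" and "q < 1"
    and "0 < \<epsilon>" and "\<epsilon> \<le> (1 - q) / 2"
    and "mono_on {0..} f"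
    and "\<And>x. 0 \<le> x \<Longrightarrow> 0 \<le> f x"
    and "l < r"
  shows "AE \<omega> in M.
    cond_probability M (F 0)
      (\<lambda>\<omega>. (\<integral>\<^sup>+ s \<in> {s. 0 \<le> s \<and> ennreal s \<le> lower_time \<kappa> l (\<lambda>_. 0) \<omega>}. ennreal (f (\<kappa> s \<omega>)) \<partial>lborel)
           \<ge> ennreal (f r * \<epsilon>) / ennreal (r * \<phi> (1 / r))) \<omega>
    \<ge> q * cond_probability M (F 0)
      (\<lambda>\<omega>. upper_time \<kappa> (2 * r / (1 - q)) (\<lambda>_. 0) \<omega> < lower_time \<kappa> l (\<lambda>_. 0) \<omega>) \<omega>"proof -
  interpret prob_space M by fact
  note filt = \<open>filtration_of M F\<close> \<open>right_continuous_filtration F\<close>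
  have rc: "((\<lambda>t. \<kappa> t \<omega>) \<longlongrightarrow> \<kappa> t \<omega>) (at_right t)" if "\<omega> \<in> space M" "0 \<le> t" for \<omega> t
    using assms(6)[OF that(1)] that(2) by (simp add: cadlag_def)
  note ge1 = assms(5) and \<phi>_mono = assms(10) and \<phi>_nonneg = assms(11)
  have r: "1 < r" using assms(8) assms(19) by simp
  have nonneg: "0 \<le> \<kappa> t \<omega>" if "\<omega> \<in> space M" "0 \<le> t" for \<omega> t
    using ge1[OF that(2,1)] by simp
  have fr: "0 \<le> f r" using assms(18)[of r] r by simp
  have \<phi>r: "0 \<le> \<phi> (1 / r)" using \<phi>_nonneg r by simp
  define R where "R = 2 * r / (1 - q)"
  have R: "0 < R" "1 / R = ((1 - q) / 2) / r"
    using r \<open>q < 1\<close> by (simp_all add: R_def)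
  define T where "T = upper_time \<kappa> R (\<lambda>_. 0)"
  define L where "L = lower_time \<kappa> l (\<lambda>_. 0)"
  define I where "I \<omega> = (\<integral>\<^sup>+ s \<in> {s. 0 \<le> s \<and> ennreal s \<le> L \<omega>}. ennreal (f (\<kappa> s \<omega>)) \<partial>lborel)" for \<omega>
  define b where "b = ennreal (f r * \<epsilon>) / ennreal (r * \<phi> (1 / r))"
  define G where "G t = stopped_sigma M F (\<lambda>\<omega>. T \<omega> + ennreal t)" for t

  have sm: "supermartingale M G (compensated_inverse \<kappa> \<phi> r T)"
    using assms(12)[OF \<open>0 < q\<close> \<open>q < 1\<close> \<open>l < r\<close>] by (simp add: Let_def T_def R_def G_def[abs_def])
  interpret filtration "space M" "with_top M F"
    using assms(2) by (simp add: filtration_of_def)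
  have stop: "stopping_time (with_top M F) T" "stopping_time (with_top M F) L"
    using stopping_time_entry_time[OF filt assms(4) rc]
    by (simp_all add: T_def L_def upper_time_zero[abs_def] lower_time_zero[abs_def])
  have sets_M: "sets (with_top M F t) \<subseteq> sets M" for t
    using sets_F_mono[of t \<infinity>] unfolding with_top_infinity by simp
  have [measurable]: "T \<in> borel_measurable M" "L \<in> borel_measurable M"
    using measurable_stopping_time[OF stop(1) sets_M space_F] measurable_stopping_time[OF stop(2) sets_M space_F]
    by auto
  have sub: "subalgebra M (F 0)"
    using assms(2) by (simp add: filtration_of_subalgebra)
  have \<kappa>_meas: "\<kappa> t \<in> borel_measurable M" if "0 \<le> t" for t
    using assms(4) measurable_from_subalg[OF filtration_of_subalgebra[OF assms(2) that]] that
    by (auto simp: adapted_def)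
  have I_meas [measurable]: "I \<in> borel_measurable M"
    unfolding I_def[abs_def] using \<kappa>_meas rc nonneg assms(17)
    by (intro measurable_integral_up_to) auto

  \<comment> \<open>This event belongs to the \<open>\<sigma>\<close>-algebra at time \<open>T\<close>, so the supermartingale can be integrated over it.\<close>
  have B_G: "A \<inter> {\<omega> \<in> space M. T \<omega> < L \<omega>} \<in> sets (G 0)" if A: "A \<in> sets (F 0)" for A
  proof -
    have G0: "G 0 = pre_sigma T"
      by (simp add: G_def stopped_sigma_def)
    have "A \<in> sets (pre_sigma T)"
    proof (rule sets_pre_sigmaI[OF stop(1)])
      fix t
      have "A \<in> sets (with_top M F t)"
        using A sets_F_mono[of 0 t] with_top_ennreal[of 0 M F] by auto
      moreover have "{\<omega> \<in> space M. T \<omega> \<le> t} \<in> sets (with_top M F t)"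
        using stopping_timeD[OF stop(1), of t] by (simp add: pred_def space_F)
      moreover have "{\<omega> \<in> A. T \<omega> \<le> t} = A \<inter> {\<omega> \<in> space M. T \<omega> \<le> t}"
        using sets.sets_into_space[OF A] sub by (auto simp: subalgebra_def)
      ultimately show "{\<omega> \<in> A. T \<omega> \<le> t} \<in> sets (with_top M F t)"
        by auto
    qed
    moreover have "{\<omega> \<in> space M. T \<omega> < L \<omega>} \<in> sets (pre_sigma T)"
      using stopping_time_less[OF stop] by (simp add: pred_def space_pre_sigma)
    ultimately show ?thesis
      by (simp add: G0 sets.Int)
  qed

  have start: "1 / \<kappa> (enn2real (T \<omega>)) \<omega> \<le> ((1 - q) / 2) / r" if \<omega>: "\<omega> \<in> space M" "T \<omega> < \<infinity>" for \<omega>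
  proof -
    have "\<kappa> (enn2real (T \<omega>)) \<omega> \<in> closure {R<..}"
      using rc \<omega> by (intro closure_at_entry_time) (auto simp: T_def upper_time_zero)
    then have "R \<le> \<kappa> (enn2real (T \<omega>)) \<omega>"
      by simp
    then have "1 / \<kappa> (enn2real (T \<omega>)) \<omega> \<le> 1 / R"
      using R(1) by (intro frac_le) auto
    then show ?thesis
      by (simp only: R(2))
  qed

  \<comment> \<open>The condition on \<open>t\<close> says that the integral of \<open>\<phi> (1 / \<kappa>)\<close> over a stay of length \<open>t\<close> above \<open>r\<close>
    is at most \<open>\<epsilon> / r\<close>.\<close>
  have stay: "q * measure M (A \<inter> {\<omega> \<in> space M. T \<omega> < L \<omega>})
      \<le> measure M (A \<inter> {\<omega> \<in> space M. ennreal (f r * t) \<le> I \<omega>})"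
    if A: "A \<in> sets (F 0)" and t: "0 \<le> t" "t * \<phi> (1 / r) \<le> \<epsilon> / r" for A t
  proof -
    let ?B = "A \<inter> {\<omega> \<in> space M. T \<omega> < L \<omega>}" and ?D = "{\<omega> \<in> space M. ennreal (f r * t) \<le> I \<omega>}"
    have AM: "A \<in> sets M"
      using A sub by (auto simp: subalgebra_def)
    have D: "?D \<in> sets M"
      by measurable
    have fin: "T \<omega> < \<infinity>" if "\<omega> \<in> ?B" for \<omega>
      using that by (auto simp: less_top[symmetric])
    have drop: "lower_time \<kappa> r T \<omega> \<le> T \<omega> + ennreal t" if "\<omega> \<in> ?B" "\<omega> \<notin> ?D" for \<omega>
    proof (rule ccontr)
      assume "\<not> ?thesis"
      then have low: "T \<omega> + ennreal t < lower_time \<kappa> r T \<omega>" and T: "T \<omega> < lower_time \<kappa> l (\<lambda>_. 0) \<omega>"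
        using that by (simp_all add: L_def)
      have "ennreal (f r * t) \<le> I \<omega>"
        unfolding I_def L_def
        using stay_before_lower_time[where \<omega> = \<omega> and T = T, OF \<open>l < r\<close> T t(1) low] assms(17) r t(1) fr
        by (intro integral_ge_of_stay[where a = "enn2real (T \<omega>)"]) auto
      with that show False by simp
    qed
    have "q * measure M ?B \<le> (1 - (1 - q) / 2 - \<epsilon>) * measure M ?B"
      using assms(16) by (intro mult_right_mono) (auto simp: field_simps)
    also have "\<dots> \<le> measure M (?B \<inter> ?D)"
      using r t fin start B_G[OF A] D drop ge1 rc
      by (intro measure_no_early_drop[OF \<open>prob_space M\<close> sm _ _ \<phi>_mono \<phi>_nonneg]) auto
    also have "\<dots> \<le> measure M (A \<inter> ?D)"
      using AM D by (intro finite_measure_mono) auto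
    finally show ?thesis .
  qed

  have "q * measure M (A \<inter> {\<omega> \<in> space M. T \<omega> < L \<omega>}) \<le> measure M (A \<inter> {\<omega> \<in> space M. b \<le> I \<omega>})"
    if A: "A \<in> sets (F 0)" for A
  proof (cases "\<phi> (1 / r) = 0")
    case False
    then have pos: "0 < \<phi> (1 / r)" using \<phi>r by simp
    have "b = ennreal (f r * (\<epsilon> / (r * \<phi> (1 / r))))"
      unfolding b_def using fr \<open>0 < \<epsilon>\<close> r pos by (simp add: divide_ennreal)
    then show ?thesis
      using stay[OF A, of "\<epsilon> / (r * \<phi> (1 / r))"] \<open>0 < \<epsilon>\<close> r pos by simp
  next
    case True
    \<comment> \<open>Now every \<open>t\<close> is allowed, while \<open>b\<close> is infinite unless \<open>f r = 0\<close>: let \<open>t\<close> run to infinity along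
      the integers.\<close>
    have AM: "A \<in> sets M"
      using A sub by (auto simp: subalgebra_def)
    define E where "E n = A \<inter> {\<omega> \<in> space M. ennreal (f r * real n) \<le> I \<omega>}" for n
    have E: "E n \<in> sets M" for n
      unfolding E_def using AM by (rule sets.Int) measurable
    have "decseq E"
    proof (rule decseq_SucI)
      fix n
      have "ennreal (f r * real n) \<le> ennreal (f r * real (Suc n))"
        using fr by (intro ennreal_leI mult_left_mono) auto
      then show "E (Suc n) \<subseteq> E n"
        unfolding E_def by (auto intro: order_trans)
    qed
    then have "(\<lambda>n. measure M (E n)) \<longlonglongrightarrow> measure M (\<Inter>n. E n)"
      using E by (intro finite_Lim_measure_decseq) auto
    moreover have "q * measure M (A \<inter> {\<omega> \<in> space M. T \<omega> < L \<omega>}) \<le> measure M (E n)" for n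
      unfolding E_def using True \<open>0 < \<epsilon>\<close> r by (intro stay[OF A]) auto
    ultimately have "q * measure M (A \<inter> {\<omega> \<in> space M. T \<omega> < L \<omega>}) \<le> measure M (\<Inter>n. E n)"
      by (intro LIMSEQ_le_const) auto
    also have "\<dots> \<le> measure M (A \<inter> {\<omega> \<in> space M. b \<le> I \<omega>})"
    proof (rule finite_measure_mono)
      show "(\<Inter>n. E n) \<subseteq> A \<inter> {\<omega> \<in> space M. b \<le> I \<omega>}"
      proof
        fix \<omega> assume \<omega>: "\<omega> \<in> (\<Inter>n. E n)"
        then have le: "ennreal (f r * real n) \<le> I \<omega>" for n
          by (auto simp: E_def)
        have "b \<le> I \<omega>"
        proof (cases "f r = 0")
          case True
          then show ?thesis by (simp add: b_def)
        next
          case False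
          then have pos: "0 < f r" using fr by simp
          have "I \<omega> = \<infinity>"
          proof (cases "I \<omega>")
            case (real x)
            then have bdd: "f r * real n \<le> x" for n
              using le[of n] by simp
            obtain n where "x < real n * f r"
              using reals_Archimedean3[OF pos] by blast
            with bdd[of n] show ?thesis
              by (simp add: mult.commute)
          qed simp
          then show ?thesis by simp
        qed
        with \<omega> show "\<omega> \<in> A \<inter> {\<omega> \<in> space M. b \<le> I \<omega>}"
          by (auto simp: E_def)
      qed
      show "A \<inter> {\<omega> \<in> space M. b \<le> I \<omega>} \<in> sets M"
        using AM by (rule sets.Int) measurable
    qed
    finally show ?thesis .
  qed
  then have "AE \<omega> in M. q * cond_probability M (F 0) (\<lambda>\<omega>. T \<omega> < L \<omega>) \<omega>
      \<le> cond_probability M (F 0) (\<lambda>\<omega>. b \<le> I \<omega>) \<omega>"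
    using sub by (intro cond_probability_mono) measurable
  then show ?thesis
    by (simp add: T_def L_def I_def b_def R_def)
qed

end
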